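(* Let $I\subseteq[0,\infty)$ be a non-empty, non-singleton interval with $0\in I$, let $p\in(0,1)$ and $c>0$, and let $f:I\to\mathbb{R}$ satisfy $$f(x)\le f(y)+c(y-x)^p\qquad\text{for all }x,y\in I\text{ with }x\le y.$$ Then there exists a nondecreasing majorant $g:I\to\mathbb{R}$ of $f$ such that for all $x\in I$, $$c\,x^p\le g(x)-f(x)\le \big(2^{1-p}c\big)x^p.$$
   Context: A majorant of $f$ is a function $g$ with $g\ge f$ on $I$. *)

theory Defs
  imports "HOL-Analysis.Analysis"
begin

text \<open>Real functions on a set \<open>I\<close> are total functions of which only the values on \<open>I\<close> matter.\<close>

definition majorant_on :: "real set \<Rightarrow> (real \<Rightarrow> real) \<Rightarrow> (real \<Rightarrow> real) \<Rightarrow> bool" where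
  "majorant_on I f g \<longleftrightarrow> (\<forall>x\<in>I. f x \<le> g x)"

end

theory Submission
  imports Defs
begin

text \<open>The majorant is the running supremum \<open>g x = sup {f t + c t\<^sup>p | t \<le> x}\<close>. The hypothesis bounds each
  \<open>f t + c t\<^sup>p\<close> by \<open>f x + c ((x - t)\<^sup>p + t\<^sup>p)\<close>, and concavity of the power gives
  \<open>(x - t)\<^sup>p + t\<^sup>p \<le> 2 (x/2)\<^sup>p\<close>.\<close>

text \<open>By concavity the power lies below its tangent at the midpoint \<open>m\<close> of
  \<open>u\<close> and \<open>v\<close> when \<open>m > 0\<close>. Adding the tangent bounds at
  \<open>u\<close> and \<open>v\<close> cancels the slope terms and leaves
  \<open>2 * m powr p\<close>.\<close>

lemma powr_add_powr_le:
  fixes u v p :: real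
  assumes "0 \<le> u" "0 \<le> v" "0 \<le> p" "p \<le> 1"
  shows "u powr p + v powr p \<le> 2 powr (1 - p) * (u + v) powr p"
proof (cases "u + v = 0")
  case True
  then have "u = 0" "v = 0" using assms by linarith+
  then show ?thesis by simp
next
  case False
  define m where "m = (u + v) / 2"
  have m: "m > 0" using False assms by (simp add: m_def)
  \<comment> \<open>Young's inequality is the tangent bound at \<open>m\<close> multiplied by
    \<open>m powr (1 - p)\<close>. It is stated for positive arguments, hence the separate case
    \<open>w = 0\<close>.\<close>
  have "w powr p * m powr (1 - p) \<le> p * w + (1 - p) * m" if "0 \<le> w" for w
    using Youngs_inequality_0[of p "1 - p" w m] assms m that by (cases "w = 0") auto
  from this[OF assms(1)] this[OF assms(2)]
  have "(u powr p + v powr p) * m powr (1 - p) \<le> p * (u + v) + (1 - p) * (2 * m)"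
    by (simp add: algebra_simps)
  also have "\<dots> = 2 * m" by (simp add: m_def field_simps)
  also have "\<dots> = (2 * m powr p) * m powr (1 - p)"
    using m by (simp flip: powr_add)
  finally have "u powr p + v powr p \<le> 2 * m powr p" using m by simp
  \<comment> \<open>The constant arises as \<open>2 * (1/2) powr p\<close>.\<close>
  also have "\<dots> = 2 powr (1 - p) * (u + v) powr p"
    using assms by (simp add: m_def powr_divide powr_diff)
  finally show ?thesis .
qed

theorem corollary2p4:
  fixes I :: "real set" and p c :: real and f :: "real \<Rightarrow> real"
  assumes "is_interval I"
    and "I \<noteq> {}"
    and "\<not> is_singleton I"
    and "I \<subseteq> {0..}"
    and "0 \<in> I"
    and "p \<in> {0<..<1}"
    and "c > 0"
    and "\<And>x y. x \<in> I \<Longrightarrow> y \<in> I \<Longrightarrow> x \<le> y \<Longrightarrow> f x \<le> f y + c * (y - x) powr p"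
  shows "\<exists>g :: real \<Rightarrow> real. mono_on I g \<and> majorant_on I f g \<and>
    (\<forall>x\<in>I. c * x powr p \<le> g x - f x \<and> g x - f x \<le> (2 powr (1 - p) * c) * x powr p)"
proof -
  define A where "A x = (\<lambda>t. f t + c * t powr p) ` (I \<inter> {..x})" for x
  define g where "g x = Sup (A x)" for x
  \<comment> \<open>One estimate serves twice: it makes the supremum finite and bounds
    \<open>g\<close> from above.\<close>
  have bound: "a \<le> f x + 2 powr (1 - p) * c * x powr p" if "x \<in> I" "a \<in> A x" for x a
  proof -
    obtain t where t: "t \<in> I" "t \<le> x" "a = f t + c * t powr p"
      using \<open>a \<in> A x\<close> by (auto simp: A_def)
    \<comment> \<open>Thus \<open>x - t\<close> and \<open>t\<close> are nonnegative with sum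
      \<open>x\<close>.\<close>
    have "t \<ge> 0" using t assms(4) by auto
    then have "(x - t) powr p + t powr p \<le> 2 powr (1 - p) * x powr p"
      using powr_add_powr_le[of "x - t" t p] t assms(6) by simp
    then have "c * ((x - t) powr p + t powr p) \<le> c * (2 powr (1 - p) * x powr p)"
      using \<open>c > 0\<close> by (intro mult_left_mono) auto
    moreover have "f t \<le> f x + c * (x - t) powr p"
      using assms(8) t that by simp
    ultimately show ?thesis using t by (simp add: algebra_simps)
  qed
  have bdd: "bdd_above (A x)" if "x \<in> I" for x
    using bound[OF that] by (meson bdd_aboveI)
  \<comment> \<open>The choice \<open>t = x\<close> makes \<open>A x\<close> nonempty and yields the
    lower bound on \<open>g\<close>.\<close>
  have mem: "f x + c * x powr p \<in> A x" if "x \<in> I" for x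
    using that by (auto simp: A_def)
  have lower: "f x + c * x powr p \<le> g x" if "x \<in> I" for x
    unfolding g_def using that by (intro cSup_upper mem bdd)
  have upper: "g x \<le> f x + 2 powr (1 - p) * c * x powr p" if "x \<in> I" for x
    unfolding g_def using mem[OF that] bound[OF that] by (intro cSup_least) auto
  have "mono_on I g"
  proof (rule mono_onI)
    fix x y assume "x \<in> I" "y \<in> I" "x \<le> y"
    moreover from this have "A x \<subseteq> A y" by (auto simp: A_def)
    ultimately show "g x \<le> g y"
      unfolding g_def using mem[of x] by (intro cSup_subset_mono bdd) auto
  qed
  moreover have "majorant_on I f g"
    unfolding majorant_on_def
  proof
    fix x assume "x \<in> I"
    have "0 \<le> c * x powr p" using \<open>c > 0\<close> by simp
    with lower[OF \<open>x \<in> I\<close>] show "f x \<le> g x" by linarith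
  qed
  moreover have "c * x powr p \<le> g x - f x \<and> g x - f x \<le> (2 powr (1 - p) * c) * x powr p"
    if "x \<in> I" for x
    using lower[OF that] upper[OF that] by linarith
  ultimately show ?thesis by blast
qed

end
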